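(* Let $C>0$ and $\frac12\leqslant\varpi\leqslant1$ be constants and let $B(|\boldsymbol{g}|,\sigma)=C|\boldsymbol{g}|^{2(1-\varpi)}$ (the VHS kernel). Then for all $\boldsymbol{j},\kappa\in\mathbb{N}^3$, $$\gamma_{\kappa}^{\boldsymbol{j}}=C\,2^{\frac52-\varpi}\left[D\big(\boldsymbol{j},\kappa,2(1-\varpi)\big)-\psi\big(\boldsymbol{j},\kappa,2(1-\varpi)\big)\right].$$
   Context: $\mathbb{N}$ includes $0$; for $\alpha\in\mathbb{N}^3$, $|\alpha|=\alpha_1+\alpha_2+\alpha_3$. The weight is $\omega(\boldsymbol{v})=(2\pi)^{-3/2}\exp(-|\boldsymbol{v}|^2/2)$ on $\mathbb{R}^3$, and the Hermite polynomials are $$H_\alpha(\boldsymbol{v})=\frac{(-1)^{|\alpha|}}{\omega(\boldsymbol{v})}\frac{\partial^{|\alpha|}}{\partial v_1^{\alpha_1}\partial v_2^{\alpha_2}\partial v_3^{\alpha_3}}\omega(\boldsymbol{v}),\qquad \alpha\in\mathbb{N}^3.$$ The restitution coefficient $e\in[0,1]$ is a constant. $S^2$ is the unit sphere in $\mathbb{R}^3$ with surface measure $\mathrm{d}\sigma$. For $\boldsymbol{g}\in\mathbb{R}^3$ and $\sigma\in S^2$ put $$\boldsymbol{g}'=\frac{1-e}{2}\boldsymbol{g}+\frac{1+e}{2}|\boldsymbol{g}|\sigma.$$ For $\boldsymbol{j},\kappa\in\mathbb{N}^3$ and a collision kernel $B$, $$\gamma_{\kappa}^{\boldsymbol{j}}=\int_{\mathbb{R}^3}\int_{S^2}\left[H_{\boldsymbol{j}}\left(\frac{\boldsymbol{g}'}{\sqrt2}\right)-H_{\boldsymbol{j}}\left(\frac{\boldsymbol{g}}{\sqrt2}\right)\right]H_{\kappa}\left(\frac{\boldsymbol{g}}{\sqrt2}\right)B(|\boldsymbol{g}|,\sigma)\,\omega\left(\frac{\boldsymbol{g}}{\sqrt2}\right)\mathrm{d}\sigma\,\mathrm{d}\boldsymbol{g}.$$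 For $\alpha,\beta\in\mathbb{N}^3$ and $\mu\geqslant0$, $$D(\alpha,\beta,\mu)=\int_{\mathbb{R}^3}\int_{S^2}H_\alpha(\boldsymbol{g}')H_\beta(\boldsymbol{g})|\boldsymbol{g}|^\mu\omega(\boldsymbol{g})\,\mathrm{d}\sigma\,\mathrm{d}\boldsymbol{g},\qquad \psi(\alpha,\beta,\mu)=\int_{\mathbb{R}^3}\int_{S^2}H_\alpha(\boldsymbol{g})H_\beta(\boldsymbol{g})|\boldsymbol{g}|^\mu\omega(\boldsymbol{g})\,\mathrm{d}\sigma\,\mathrm{d}\boldsymbol{g}.$$ *)

theory Defs
  imports "HOL-Analysis.Analysis"
begin

definition partial_deriv :: "3 \<Rightarrow> (real^3 \<Rightarrow> real) \<Rightarrow> real^3 \<Rightarrow> real" where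
  "partial_deriv i f v = deriv (\<lambda>t. f (v + t *\<^sub>R axis i 1)) 0"

definition multi_deriv :: "nat^3 \<Rightarrow> (real^3 \<Rightarrow> real) \<Rightarrow> real^3 \<Rightarrow> real" where
  "multi_deriv \<alpha> f =
     (partial_deriv 1 ^^ (\<alpha> $ 1)) ((partial_deriv 2 ^^ (\<alpha> $ 2)) ((partial_deriv 3 ^^ (\<alpha> $ 3)) f))"

definition weight :: "real^3 \<Rightarrow> real" where
  "weight v = (2 * pi) powr (- 3 / 2) * exp (- (norm v)\<^sup>2 / 2)"

definition hermite :: "nat^3 \<Rightarrow> real^3 \<Rightarrow> real" where
  "hermite \<alpha> v = (- 1) ^ (\<alpha> $ 1 + \<alpha> $ 2 + \<alpha> $ 3) / weight v * multi_deriv \<alpha> weight v"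

(* Surface measure of the unit sphere as the cone measure: a Borel set A of directions has measure
   3 times the volume of the part of the unit ball lying over A; see emeasure_sphere_measure,
   emeasure_sphere_measure_total and sphere_measure_rotation_invariant below. *)
definition sphere_measure :: "(real^3) measure" where
  "sphere_measure =
     scale_measure 3 (distr (restrict_space lborel (cball 0 1 - {0}))
       (restrict_space borel (sphere 0 1)) (\<lambda>x. x /\<^sub>R norm x))"

definition post_velocity :: "real \<Rightarrow> real^3 \<Rightarrow> real^3 \<Rightarrow> real^3" where
  "post_velocity e g \<sigma> = ((1 - e) / 2) *\<^sub>R g + ((1 + e) / 2 * norm g) *\<^sub>R \<sigma>"

(* Real power with the convention x to the 0 is 1 also at x = 0, unlike powr. *)
definition rpow :: "real \<Rightarrow> real \<Rightarrow> real" where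
  "rpow x \<mu> = (if \<mu> = 0 then 1 else x powr \<mu>)"

definition gamma_coeff :: "real \<Rightarrow> (real \<Rightarrow> real^3 \<Rightarrow> real) \<Rightarrow> nat^3 \<Rightarrow> nat^3 \<Rightarrow> real" where
  "gamma_coeff e B j \<kappa> =
     (LINT g|lborel. (LINT \<sigma>|sphere_measure.
        (hermite j (post_velocity e g \<sigma> /\<^sub>R sqrt 2) - hermite j (g /\<^sub>R sqrt 2))
          * hermite \<kappa> (g /\<^sub>R sqrt 2) * B (norm g) \<sigma> * weight (g /\<^sub>R sqrt 2)))"

definition D_coeff :: "real \<Rightarrow> nat^3 \<Rightarrow> nat^3 \<Rightarrow> real \<Rightarrow> real" where
  "D_coeff e \<alpha> \<beta> \<mu> =
     (LINT g|lborel. (LINT \<sigma>|sphere_measure.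
        hermite \<alpha> (post_velocity e g \<sigma>) * hermite \<beta> g * rpow (norm g) \<mu> * weight g))"

definition psi_coeff :: "nat^3 \<Rightarrow> nat^3 \<Rightarrow> real \<Rightarrow> real" where
  "psi_coeff \<alpha> \<beta> \<mu> =
     (LINT g|lborel. (LINT \<sigma>|sphere_measure.
        hermite \<alpha> g * hermite \<beta> g * rpow (norm g) \<mu> * weight g))"

lemma space_sphere_measure [simp]: "space sphere_measure = sphere 0 1"
  by (simp add: sphere_measure_def space_scale_measure space_restrict_space)

lemma sets_sphere_measure [measurable_cong, simp]:
  "sets sphere_measure = sets (restrict_space borel (sphere 0 1))"
  by (simp add: sphere_measure_def)

lemma measurable_direction:
  "(\<lambda>x::real^3. x /\<^sub>R norm x)
     \<in> restrict_space lborel (cball 0 1 - {0}) \<rightarrow>\<^sub>M restrict_space borel (sphere 0 1)"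
  by (rule measurable_restrict_space2)
     (auto simp: space_restrict_space intro!: measurable_restrict_space1)

lemma emeasure_sphere_measure:
  assumes A: "A \<in> sets (restrict_space borel (sphere 0 1))"
  shows "emeasure sphere_measure A
     = 3 * emeasure lborel {r *\<^sub>R x |r x. 0 < r \<and> r \<le> 1 \<and> x \<in> A}"
proof -
  let ?N = "restrict_space lborel (cball 0 1 - {0::real^3})"
  let ?P = "(\<lambda>x::real^3. x /\<^sub>R norm x) -` A \<inter> space ?N"
  have sub: "A \<subseteq> sphere 0 1"
    using A by (auto simp: sets_restrict_space)
  have "?P = {r *\<^sub>R x |r x. 0 < r \<and> r \<le> 1 \<and> x \<in> A}" (is "_ = ?C")
  proof (intro set_eqI iffI)
    fix y assume y: "y \<in> ?P"
    then have "y = norm y *\<^sub>R (y /\<^sub>R norm y)" "0 < norm y" "norm y \<le> 1" "y /\<^sub>R norm y \<in> A"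
      by (auto simp: space_restrict_space)
    then show "y \<in> ?C" by blast
  next
    fix y assume "y \<in> ?C"
    then obtain r x where r: "y = r *\<^sub>R x" "0 < r" "r \<le> 1" "x \<in> A" by blast
    moreover have "norm x = 1" using r sub by auto
    ultimately show "y \<in> ?P" by (auto simp: space_restrict_space)
  qed
  moreover have "emeasure sphere_measure A = 3 * emeasure ?N ?P"
    using A by (simp add: sphere_measure_def emeasure_distr[OF measurable_direction])
  moreover have "emeasure ?N ?P = emeasure lborel ?P"
    by (subst emeasure_restrict_space) (auto simp: space_restrict_space)
  ultimately show ?thesis by simp
qed

lemma emeasure_sphere_measure_total: "emeasure sphere_measure (sphere 0 1) = ennreal (4 * pi)"
proof -
  have "{r *\<^sub>R x |r x. 0 < r \<and> r \<le> 1 \<and> x \<in> sphere (0::real^3) 1} = cball 0 1 - {0}" (is "?C = _")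
  proof (intro set_eqI iffI)
    fix y :: "real^3" assume "y \<in> cball 0 1 - {0}"
    then have "y = norm y *\<^sub>R (y /\<^sub>R norm y)" "0 < norm y" "norm y \<le> 1" "y /\<^sub>R norm y \<in> sphere 0 1"
      by auto
    then show "y \<in> ?C" by blast
  qed auto
  moreover have "sphere (0::real^3) 1 \<in> sets (restrict_space borel (sphere 0 1))"
    by (auto simp: sets_restrict_space)
  moreover have "emeasure lborel (cball 0 1 - {0::real^3}) = emeasure lborel (cball (0::real^3) 1)"
    by (subst emeasure_Diff) auto
  moreover have "emeasure lborel (cball (0::real^3) 1) = ennreal (4 / 3 * pi)"
    by (simp add: emeasure_cball eval_unit_ball_vol)
  ultimately show ?thesis
    by (simp add: emeasure_sphere_measure flip: ennreal_numeral ennreal_mult)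
qed

lemma sphere_measure_rotation_invariant:
  fixes T :: "real^3 \<Rightarrow> real^3"
  assumes T: "orthogonal_transformation T"
    and A: "A \<in> sets sphere_measure"
  shows "T ` A \<in> sets sphere_measure"
    and "emeasure sphere_measure (T ` A) = emeasure sphere_measure A"
proof -
  have lin: "linear T" and norm_T: "\<And>x. norm (T x) = norm x"
    using T by (auto simp: orthogonal_transformation)
  have bij: "bij T" using orthogonal_transformation_bij[OF T] .
  have inv_T: "orthogonal_transformation (inv T)"
    using orthogonal_transformation_inv[OF T] .
  have img: "T ` S = inv T -` S" for S
    using bij by (simp add: bij_vimage_eq_inv_image bij_imp_bij_inv inv_inv_eq)
  have cont: "continuous_on UNIV (inv T)"
    using inv_T by (simp add: orthogonal_transformation_linear linear_continuous_on linear_linear)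
  have meas: "inv T \<in> borel_measurable borel"
    using cont by (rule borel_measurable_continuous_onI)
  have A_borel: "A \<in> sets borel" "A \<subseteq> sphere 0 1"
    using A by (auto simp: sets_restrict_space)
  have "T ` A \<in> sets borel"
    using measurable_sets[OF meas A_borel(1)] by (simp add: img)
  moreover have "T ` A \<subseteq> sphere 0 1"
    using A_borel(2) norm_T by auto
  ultimately show TA: "T ` A \<in> sets sphere_measure"
    by (auto simp: sets_restrict_space)
  let ?C = "\<lambda>A. {r *\<^sub>R x |r x. 0 < r \<and> r \<le> 1 \<and> x \<in> (A :: (real^3) set)}"
  have cone_eq: "?C A = (cball 0 1 - {0}) \<inter> (\<lambda>x. x /\<^sub>R norm x) -` A"
  proof (intro set_eqI iffI)
    fix y assume y: "y \<in> (cball 0 1 - {0}) \<inter> (\<lambda>x. x /\<^sub>R norm x) -` A"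
    then have "y = norm y *\<^sub>R (y /\<^sub>R norm y)" "0 < norm y" "norm y \<le> 1" "y /\<^sub>R norm y \<in> A" by auto
    then show "y \<in> ?C A" by blast
  next
    fix y assume "y \<in> ?C A"
    then obtain r x where r: "y = r *\<^sub>R x" "0 < r" "r \<le> 1" "x \<in> A" by blast
    moreover have "norm x = 1" using r A_borel by auto
    ultimately show "y \<in> (cball 0 1 - {0}) \<inter> (\<lambda>x. x /\<^sub>R norm x) -` A" by auto
  qed
  have "(\<lambda>x::real^3. x /\<^sub>R norm x) -` A \<inter> space borel \<in> sets borel"
    using A_borel(1) by (intro measurable_sets[of _ borel borel]) auto
  then have C: "?C A \<in> sets borel"
    unfolding cone_eq by auto
  have TC: "?C (T ` A) = T ` ?C A"
    using lin by (force simp: linear_scale)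
  have TC_borel: "T ` ?C A \<in> sets borel"
    using measurable_sets[OF meas C] by (simp add: img)
  have bnd: "bounded (?C A)"
    unfolding cone_eq by (rule bounded_subset[OF bounded_cball[of 0 1]]) auto
  have bnd_T: "bounded (T ` ?C A)"
    using bnd lin by (simp add: bounded_linear_image linear_linear)
  have "measure lebesgue (T ` ?C A) = measure lebesgue (?C A)"
    using C bnd T by (intro measure_orthogonal_image) (auto intro: bounded_set_imp_lmeasurable)
  then have eq: "measure lborel (T ` ?C A) = measure lborel (?C A)"
    using C TC_borel by (simp add: measure_completion)
  have "emeasure lborel (T ` ?C A) = ennreal (measure lborel (T ` ?C A))"
    by (rule emeasure_eq_ennreal_measure)
       (rule emeasure_bounded_finite[OF bnd_T, THEN less_imp_neq, unfolded infinity_ennreal_def])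
  also have "\<dots> = ennreal (measure lborel (?C A))"
    by (simp only: eq)
  also have "\<dots> = emeasure lborel (?C A)"
    by (rule emeasure_eq_ennreal_measure[symmetric])
       (rule emeasure_bounded_finite[OF bnd, THEN less_imp_neq, unfolded infinity_ennreal_def])
  finally have "emeasure lborel (T ` ?C A) = emeasure lborel (?C A)" .
  then show "emeasure sphere_measure (T ` A) = emeasure sphere_measure A"
    using A TA by (simp add: emeasure_sphere_measure TC)
qed

end

theory Submission
  imports Defs "HOL-Probability.Distributions"
begin

text \<open>The identity is the substitution \<open>g = sqrt 2 h\<close>. The post-collision velocity is
  positively homogeneous in the relative velocity, so every argument \<open>g / sqrt 2\<close> or
  \<open>g' / sqrt 2\<close> becomes \<open>h\<close> or \<open>h'\<close>; the volume element contributes \<open>2 powr (3/2)\<close> and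
  the kernel \<open>C * 2 powr (1 - varpi)\<close>, which multiply to the stated constant.

  What needs an argument is that the integral of the difference is the difference of the integrals,
  because the Bochner integral of a non-integrable function is \<open>0\<close> by convention. Differentiation
  along a coordinate axis maps \<open>weight * polynomial\<close> to \<open>weight * polynomial\<close>, so Hermite
  functions are polynomials (\<open>real_polynomial_function_hermite\<close>) and grow at most like a
  power of \<open>1 + norm v\<close>. A collision does not lengthen the relative velocity
  (\<open>norm_post_velocity_le\<close>), so the integrand is bounded, uniformly in the direction, by a
  power of \<open>1 + norm g\<close> times the Gaussian weight, which is integrable
  (\<open>integrable_power_weight\<close>). As the sphere has finite measure, both iterated integrals exist.

  The integral \<open>psi\<close> is the integral \<open>D\<close> at restitution coefficient \<open>-1\<close>, where a
  collision leaves the velocity unchanged. Stating the bounds for all coefficients in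
  \<open>[-1, 1]\<close> therefore treats both integrals at once.\<close>

section \<open>Hermite functions are polynomials\<close>

lemma real_polynomial_function_directional_derivative:
  fixes p :: "'a::real_normed_vector \<Rightarrow> real"
  assumes "real_polynomial_function p"
  shows "\<exists>q. real_polynomial_function q \<and>
    (\<forall>v. ((\<lambda>t. p (v + t *\<^sub>R a)) has_real_derivative q v) (at 0))"
  using assms
proof induction
  case (linear f)
  then interpret bounded_linear f .
  have "((\<lambda>t. f (v + t *\<^sub>R a)) has_real_derivative f a) (at 0)" for v
    by (auto simp: add scaleR intro!: derivative_eq_intros)
  then show ?case by (intro exI[of _ "\<lambda>_. f a"]) auto
next
  case (const c)
  then show ?case by (intro exI[of _ "\<lambda>_. 0"]) auto
next
  case (add f g)
  then obtain f' g' where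
    "real_polynomial_function f'" "real_polynomial_function g'"
    "\<And>v. ((\<lambda>t. f (v + t *\<^sub>R a)) has_real_derivative f' v) (at 0)"
    "\<And>v. ((\<lambda>t. g (v + t *\<^sub>R a)) has_real_derivative g' v) (at 0)"
    by auto
  then show ?case
    by (intro exI[of _ "\<lambda>v. f' v + g' v"]) (auto intro: DERIV_add)
next
  case (mult f g)
  then obtain f' g' where *:
    "real_polynomial_function f'" "real_polynomial_function g'"
    "\<And>v. ((\<lambda>t. f (v + t *\<^sub>R a)) has_real_derivative f' v) (at 0)"
    "\<And>v. ((\<lambda>t. g (v + t *\<^sub>R a)) has_real_derivative g' v) (at 0)"
    by auto
  have "((\<lambda>t. f (v + t *\<^sub>R a) * g (v + t *\<^sub>R a))
      has_real_derivative f' v * g v + g' v * f v) (at 0)" for v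
    using DERIV_mult[OF *(3)[of v] *(4)[of v]] by simp
  moreover have "real_polynomial_function (\<lambda>v. f' v * g v + g' v * f v)"
    using mult * by auto
  ultimately show ?case by blast
qed

text \<open>Along the line through \<open>v\<close> in direction \<open>i\<close> the exponent is the quadratic polynomial
  \<open>- ((norm v)\<^sup>2 + 2 t v\<^sub>i + t\<^sup>2) / 2\<close>, with slope \<open>- v\<^sub>i\<close> at \<open>t = 0\<close>.\<close>

lemma weight_has_directional_derivative:
  "((\<lambda>t. weight (v + t *\<^sub>R axis i 1)) has_real_derivative - (v $ i) * weight v) (at 0)"
proof -
  have "(norm (v + t *\<^sub>R axis i 1))\<^sup>2 = (norm v)\<^sup>2 + 2 * t * v $ i + t\<^sup>2" for t
    unfolding power2_norm_eq_inner
    by (simp add: inner_add_left inner_add_right inner_axis inner_axis' power2_eq_square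
        algebra_simps)
  then show ?thesis
    unfolding weight_def by (auto intro!: derivative_eq_intros)
qed

text \<open>The product rule turns the factor \<open>p\<close> into \<open>\<partial>\<^sub>i p - v\<^sub>i p\<close>. This closure
  property lets the iterated derivatives of the weight be taken one at a time.\<close>

lemma partial_deriv_weight_mult_polynomial:
  assumes p: "real_polynomial_function p"
  shows "\<exists>q. real_polynomial_function q \<and>
    partial_deriv i (\<lambda>v. weight v * p v) = (\<lambda>v. weight v * q v)"
proof -
  obtain p' where p': "real_polynomial_function p'"
    "\<And>v. ((\<lambda>t. p (v + t *\<^sub>R axis i 1)) has_real_derivative p' v) (at 0)"
    using real_polynomial_function_directional_derivative[OF p, of "axis i 1"] by blast
  have "real_polynomial_function (\<lambda>v. p' v - v $ i * p v)"
    using p p'(1)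
    by (intro real_polynomial_function_diff real_polynomial_function.intros(4)
        real_polynomial_function.intros(1)[OF bounded_linear_vec_nth])
  moreover have "partial_deriv i (\<lambda>v. weight v * p v) v = weight v * (p' v - v $ i * p v)" for v
    unfolding partial_deriv_def
    using DERIV_mult[OF weight_has_directional_derivative[of v i] p'(2)[of v]]
    by (intro DERIV_imp_deriv) (simp add: algebra_simps)
  ultimately show ?thesis by blast
qed

lemma partial_deriv_funpow_weight_mult_polynomial:
  assumes "real_polynomial_function p"
  shows "\<exists>q. real_polynomial_function q \<and>
    (partial_deriv i ^^ n) (\<lambda>v. weight v * p v) = (\<lambda>v. weight v * q v)"
proof (induction n)
  case 0
  show ?case using assms by auto
next
  case (Suc n)
  then show ?case using partial_deriv_weight_mult_polynomial by auto
qed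

text \<open>Starting from \<open>weight * 1\<close>, all the derivatives in the Rodrigues formula keep the form
  \<open>weight * polynomial\<close>, and the division by the weight leaves the polynomial.\<close>

lemma real_polynomial_function_hermite: "real_polynomial_function (hermite \<alpha>)"
proof -
  note step = partial_deriv_funpow_weight_mult_polynomial
  have "real_polynomial_function (\<lambda>_::real^3. 1::real)" by auto
  from step[OF this, where i = 3 and n = "\<alpha> $ 3"] obtain q3 where q3: "real_polynomial_function q3"
    "(partial_deriv 3 ^^ (\<alpha> $ 3)) weight = (\<lambda>v. weight v * q3 v)" by auto
  from step[OF q3(1), where i = 2 and n = "\<alpha> $ 2"] obtain q2 where q2: "real_polynomial_function q2"
    "(partial_deriv 2 ^^ (\<alpha> $ 2)) (\<lambda>v. weight v * q3 v) = (\<lambda>v. weight v * q2 v)" by auto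
  from step[OF q2(1), where i = 1 and n = "\<alpha> $ 1"] obtain q1 where q1: "real_polynomial_function q1"
    "(partial_deriv 1 ^^ (\<alpha> $ 1)) (\<lambda>v. weight v * q2 v) = (\<lambda>v. weight v * q1 v)" by auto
  have "weight v \<noteq> 0" for v by (simp add: weight_def)
  then have "hermite \<alpha> = (\<lambda>v. (- 1) ^ (\<alpha> $ 1 + \<alpha> $ 2 + \<alpha> $ 3) * q1 v)"
    by (simp add: fun_eq_iff hermite_def multi_deriv_def q1(2) q2(2) q3(2))
  then show ?thesis using q1(1) by auto
qed

section \<open>Polynomial growth against the Gaussian weight\<close>

text \<open>The base \<open>1 + norm v\<close> is at least \<open>1\<close>, so its powers increase with the exponent:
  the exponent \<open>m + n\<close> of a product also bounds a sum.\<close>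

lemma real_polynomial_function_growth:
  fixes p :: "'a::real_normed_vector \<Rightarrow> real"
  assumes "real_polynomial_function p"
  shows "\<exists>K n. 0 \<le> K \<and> (\<forall>v. \<bar>p v\<bar> \<le> K * (1 + norm v) ^ n)"
  using assms
proof induction
  case (linear f)
  then obtain K where K: "0 \<le> K" "\<And>v. \<bar>f v\<bar> \<le> norm v * K"
    using bounded_linear.nonneg_bounded[of f] by auto
  have "\<bar>f v\<bar> \<le> K * (1 + norm v) ^ 1" for v
    using K(1) K(2)[of v] by (simp add: algebra_simps)
  with K(1) show ?case by blast
next
  case (const c)
  show ?case by (intro exI[of _ "\<bar>c\<bar>"] exI[of _ 0]) auto
next
  case (add f g)
  then obtain K m L n where KL: "0 \<le> K" "\<And>v. \<bar>f v\<bar> \<le> K * (1 + norm v) ^ m"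
      "0 \<le> L" "\<And>v. \<bar>g v\<bar> \<le> L * (1 + norm v) ^ n" by blast
  have "\<bar>f v + g v\<bar> \<le> (K + L) * (1 + norm v) ^ (m + n)" for v
  proof -
    have "(1 + norm v) ^ m \<le> (1 + norm v) ^ (m + n)" "(1 + norm v) ^ n \<le> (1 + norm v) ^ (m + n)"
      by (auto intro!: power_increasing)
    then have "K * (1 + norm v) ^ m + L * (1 + norm v) ^ n \<le> (K + L) * (1 + norm v) ^ (m + n)"
      unfolding distrib_right using KL(1,3) by (intro add_mono mult_left_mono)
    then show ?thesis using KL(2)[of v] KL(4)[of v] by linarith
  qed
  then show ?case using KL(1,3) by (intro exI[of _ "K + L"] exI[of _ "m + n"]) auto
next
  case (mult f g)
  then obtain K m L n where KL: "0 \<le> K" "\<And>v. \<bar>f v\<bar> \<le> K * (1 + norm v) ^ m"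
      "0 \<le> L" "\<And>v. \<bar>g v\<bar> \<le> L * (1 + norm v) ^ n" by blast
  have "\<bar>f v * g v\<bar> \<le> (K * L) * (1 + norm v) ^ (m + n)" for v
    using mult_mono[OF KL(2)[of v] KL(4)[of v]] KL(1,3)
    by (simp add: abs_mult power_add mult_ac)
  then show ?case using KL(1,3) by (intro exI[of _ "K * L"] exI[of _ "m + n"]) auto
qed

lemma continuous_on_real_polynomial_function:
  assumes "real_polynomial_function (p :: 'a::real_normed_vector \<Rightarrow> real)"
  shows "continuous_on S p"
  using assms by (simp add: real_polynomial_function_eq continuous_on_polymonial_function)

text \<open>The Gaussian is the product over an orthonormal basis of one-dimensional Gaussians, each a
  multiple of a normal density.\<close>

lemma integrable_gaussian_euclidean:
  assumes "0 < c"
  shows "integrable lborel (\<lambda>x::'a::euclidean_space. exp (- c * (norm x)\<^sup>2))"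
proof (rule integrableI_nonneg)
  have one: "(\<integral>\<^sup>+ x. ennreal (exp (- c * x\<^sup>2)) \<partial>lborel) < \<infinity>"
  proof -
    \<comment> \<open>the standard deviation for which the density has exponent \<open>- c * x\<^sup>2\<close>\<close>
    define s where "s = sqrt (1 / (2 * c))"
    have s: "0 < s" "2 * s\<^sup>2 = 1 / c" using assms by (auto simp: s_def)
    have "integrable lborel (\<lambda>x. sqrt (2 * pi * s\<^sup>2) * normal_density 0 s x)"
      using s(1) by (intro integrable_mult_right integrable_normal_density)
    also have "(\<lambda>x. sqrt (2 * pi * s\<^sup>2) * normal_density 0 s x) = (\<lambda>x. exp (- c * x\<^sup>2))"
      using s(1) by (simp add: fun_eq_iff normal_density_def s(2))
    finally show ?thesis
      by (simp add: integrable_iff_bounded)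
  qed
  have "(norm x)\<^sup>2 = (\<Sum>b\<in>Basis. (x \<bullet> b)\<^sup>2)" for x :: 'a
    unfolding power2_norm_eq_inner by (subst euclidean_inner) (simp add: power2_eq_square)
  then have "ennreal (exp (- c * (norm x)\<^sup>2)) = (\<Prod>b\<in>Basis. ennreal (exp (- c * (x \<bullet> b)\<^sup>2)))" for x :: 'a
    by (simp add: sum_distrib_left exp_sum prod_ennreal flip: sum_negf)
  then have "(\<integral>\<^sup>+ x. ennreal (exp (- c * (norm (x::'a))\<^sup>2)) \<partial>lborel)
      = (\<Prod>b\<in>(Basis::'a set). \<integral>\<^sup>+ x. ennreal (exp (- c * x\<^sup>2)) \<partial>lborel)"
    using nn_integral_lborel_prod[where 'a = 'a and f = "\<lambda>_ x. ennreal (exp (- c * x\<^sup>2))"]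
    by simp
  also have "\<dots> < \<infinity>"
    using one by (simp add: power_less_top_ennreal)
  finally show "(\<integral>\<^sup>+ x. ennreal (exp (- c * (norm (x::'a))\<^sup>2)) \<partial>lborel) < \<infinity>" .
qed auto

text \<open>Half of the Gaussian exponent absorbs the power: \<open>(1 + r) ^ n \<le> exp (n r)\<close>, and
  completing the square gives \<open>n r - r\<^sup>2 / 2 \<le> n\<^sup>2 - r\<^sup>2 / 4\<close>.\<close>

lemma integrable_power_weight: "integrable lborel (\<lambda>g. (1 + norm g) ^ n * weight g)"
proof (rule Bochner_Integration.integrable_bound)
  let ?c = "(2 * pi) powr (- 3 / 2) * exp (real n ^ 2)"
  show "integrable lborel (\<lambda>g::real^3. ?c * exp (- (1/4) * (norm g)\<^sup>2))"
    by (intro integrable_mult_right integrable_gaussian_euclidean) auto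
  show "(\<lambda>g. (1 + norm g) ^ n * weight g) \<in> borel_measurable lborel"
    unfolding weight_def by measurable
  have "(1 + r) ^ n * exp (- r\<^sup>2 / 2) \<le> exp (real n ^ 2) * exp (- (1/4) * r\<^sup>2)" if "0 \<le> r" for r :: real
  proof -
    have "(1 + r) ^ n \<le> exp r ^ n"
      using that by (intro power_mono exp_ge_add_one_self) auto
    also have "\<dots> = exp (n * r)" by (simp add: exp_of_nat_mult)
    finally have "(1 + r) ^ n * exp (- r\<^sup>2 / 2) \<le> exp (n * r - r\<^sup>2 / 2)"
      by (simp add: exp_diff exp_minus divide_right_mono flip: divide_inverse)
    also have "0 \<le> (real n - r / 2)\<^sup>2" by simp
    then have "n * r - r\<^sup>2 / 2 \<le> real n ^ 2 + - (1/4) * r\<^sup>2"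
      by (simp add: power2_eq_square algebra_simps)
    then have "exp (n * r - r\<^sup>2 / 2) \<le> exp (real n ^ 2) * exp (- (1/4) * r\<^sup>2)"
      by (simp flip: exp_add)
    finally show ?thesis .
  qed
  from this[OF norm_ge_zero]
  show "AE g in lborel. norm ((1 + norm g) ^ n * weight g)
      \<le> norm (?c * exp (- (1/4) * (norm g)\<^sup>2))"
    by (intro AE_I2) (simp add: weight_def abs_mult mult.left_commute)
qed

lemma rpow_le_power:
  assumes "0 \<le> x" "0 \<le> \<mu>"
  shows "rpow x \<mu> \<le> (1 + x) ^ nat \<lceil>\<mu>\<rceil>"
proof (cases "\<mu> = 0")
  case False
  have "x powr \<mu> \<le> (1 + x) powr \<mu>" using assms by (intro powr_mono2) auto
  also have "\<dots> \<le> (1 + x) powr real (nat \<lceil>\<mu>\<rceil>)"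
    using assms by (intro powr_mono) (auto simp: real_nat_ceiling_ge)
  also have "\<dots> = (1 + x) ^ nat \<lceil>\<mu>\<rceil>"
    using assms by (intro powr_realpow) auto
  finally show ?thesis using False by (simp add: rpow_def)
qed (simp add: rpow_def)

lemma rpow_nonneg: "0 \<le> x \<Longrightarrow> 0 \<le> rpow x \<mu>"
  by (simp add: rpow_def)

lemma rpow_mult: "0 \<le> x \<Longrightarrow> 0 \<le> y \<Longrightarrow> rpow (x * y) \<mu> = rpow x \<mu> * rpow y \<mu>"
  by (simp add: rpow_def powr_mult)

section \<open>Integrability over directions and relative velocities\<close>

lemma finite_measure_sphere_measure: "finite_measure sphere_measure"
  by (rule finite_measureI) (simp add: emeasure_sphere_measure_total)

lemma post_velocity_scaleR:
  "0 \<le> c \<Longrightarrow> post_velocity e (c *\<^sub>R g) \<sigma> = c *\<^sub>R post_velocity e g \<sigma>"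
  by (simp add: post_velocity_def scaleR_add_right mult_ac)

text \<open>The value \<open>-1\<close> of the restitution coefficient encodes the absence of a collision.\<close>

lemma post_velocity_minus_one: "post_velocity (- 1) g \<sigma> = g"
  by (simp add: post_velocity_def)

text \<open>For these \<open>e\<close> both coefficients are nonnegative, so the post-collision velocity is a convex
  combination of \<open>g\<close> and \<open>norm g *\<^sub>R \<sigma>\<close>, two vectors of the same length.\<close>

lemma norm_post_velocity_le:
  assumes "- 1 \<le> e" "e \<le> 1" "\<sigma> \<in> sphere 0 1"
  shows "norm (post_velocity e g \<sigma>) \<le> norm g"
proof -
  have "norm (post_velocity e g \<sigma>) \<le> (1 - e) / 2 * norm g + (1 + e) / 2 * norm g"
    using norm_triangle_ineq[of "((1 - e) / 2) *\<^sub>R g" "((1 + e) / 2 * norm g) *\<^sub>R \<sigma>"] assms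
    by (simp add: post_velocity_def)
  also have "\<dots> = norm g" by (simp add: field_simps)
  finally show ?thesis .
qed

text \<open>The bound does not depend on \<open>\<sigma>\<close>: it serves as a constant for the integral over the
  sphere and as an integrable majorant for the integral over \<open>g\<close>.\<close>

lemma collision_integrand_bound:
  assumes p: "real_polynomial_function p" and q: "real_polynomial_function q"
    and \<mu>: "0 \<le> \<mu>" and e: "- 1 \<le> e" "e \<le> 1"
  shows "\<exists>K n. 0 \<le> K \<and> (\<forall>g. \<forall>\<sigma>\<in>sphere 0 1.
    \<bar>p (post_velocity e g \<sigma>) * q g * rpow (norm g) \<mu> * weight g\<bar>
      \<le> K * ((1 + norm g) ^ n * weight g))"
proof -
  obtain K m where K: "0 \<le> K" "\<And>v. \<bar>p v\<bar> \<le> K * (1 + norm v) ^ m"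
    using real_polynomial_function_growth[OF p] by blast
  obtain L n where L: "0 \<le> L" "\<And>v. \<bar>q v\<bar> \<le> L * (1 + norm v) ^ n"
    using real_polynomial_function_growth[OF q] by blast
  have "\<bar>p (post_velocity e g \<sigma>) * q g * rpow (norm g) \<mu> * weight g\<bar>
      \<le> (K * L) * ((1 + norm g) ^ (m + n + nat \<lceil>\<mu>\<rceil>) * weight g)" if "\<sigma> \<in> sphere 0 1" for g \<sigma>
  proof -
    have "\<bar>p (post_velocity e g \<sigma>)\<bar> \<le> K * (1 + norm (post_velocity e g \<sigma>)) ^ m" by (rule K)
    also have "\<dots> \<le> K * (1 + norm g) ^ m"
      using norm_post_velocity_le[OF e that] K(1) by (intro mult_left_mono power_mono) auto
    finally have "\<bar>p (post_velocity e g \<sigma>)\<bar> * \<bar>q g\<bar> * \<bar>rpow (norm g) \<mu>\<bar>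
        \<le> (K * (1 + norm g) ^ m) * (L * (1 + norm g) ^ n) * (1 + norm g) ^ nat \<lceil>\<mu>\<rceil>"
      using K(1) L rpow_le_power[of "norm g" \<mu>] rpow_nonneg[of "norm g" \<mu>] \<mu>
      by (intro mult_mono) auto
    moreover have "0 \<le> weight g" by (simp add: weight_def)
    ultimately show ?thesis
      using mult_right_mono[of _ _ "weight g"] by (fastforce simp: abs_mult power_add mult_ac)
  qed
  then show ?thesis
    using K(1) L(1) by (intro exI[of _ "K * L"] exI[of _ "m + n + nat \<lceil>\<mu>\<rceil>"]) auto
qed

lemma collision_integrand_measurable:
  assumes p: "real_polynomial_function p" and q: "real_polynomial_function q"
  shows "(\<lambda>(g, \<sigma>). p (post_velocity e g \<sigma>) * q g * rpow (norm g) \<mu> * weight g)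
    \<in> borel_measurable (borel \<Otimes>\<^sub>M sphere_measure)"
proof -
  have [measurable]: "p \<in> borel_measurable borel" "q \<in> borel_measurable borel"
    using p q by (auto intro!: borel_measurable_continuous_onI continuous_on_real_polynomial_function)
  have "(\<lambda>\<sigma>. \<sigma>) \<in> restrict_space borel (sphere 0 1) \<rightarrow>\<^sub>M (borel :: (real^3) measure)"
    by (intro measurable_restrict_space1) simp
  then have id[measurable]: "(\<lambda>\<sigma>. \<sigma>) \<in> sphere_measure \<rightarrow>\<^sub>M (borel :: (real^3) measure)"
    using measurable_cong_sets[OF sets_sphere_measure refl] by blast
  have [measurable]: "snd \<in> borel \<Otimes>\<^sub>M sphere_measure \<rightarrow>\<^sub>M (borel :: (real^3) measure)"
    using measurable_compose[OF measurable_snd id] by simp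
  show ?thesis
    unfolding post_velocity_def rpow_def weight_def case_prod_beta by measurable
qed

lemma integrable_collision_integrand_direction:
  assumes "real_polynomial_function p" "real_polynomial_function q"
    and "0 \<le> \<mu>" "- 1 \<le> e" "e \<le> 1"
  shows "integrable sphere_measure
    (\<lambda>\<sigma>. p (post_velocity e g \<sigma>) * q g * rpow (norm g) \<mu> * weight g)"
proof -
  interpret finite_measure sphere_measure by (rule finite_measure_sphere_measure)
  obtain K n where "\<forall>g. \<forall>\<sigma>\<in>sphere 0 1.
      \<bar>p (post_velocity e g \<sigma>) * q g * rpow (norm g) \<mu> * weight g\<bar>
        \<le> K * ((1 + norm g) ^ n * weight g)"
    using collision_integrand_bound[OF assms] by blast
  moreover have "(\<lambda>\<sigma>. p (post_velocity e g \<sigma>) * q g * rpow (norm g) \<mu> * weight g)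
      \<in> borel_measurable sphere_measure"
    using measurable_Pair2[OF collision_integrand_measurable[OF assms(1,2)], of g] by simp
  ultimately show ?thesis
    by (intro integrable_const_bound[where B = "K * ((1 + norm g) ^ n * weight g)"] AE_I2) auto
qed

lemma collision_integral_measurable:
  assumes "real_polynomial_function p" "real_polynomial_function q"
  shows "(\<lambda>g. LINT \<sigma>|sphere_measure. p (post_velocity e g \<sigma>) * q g * rpow (norm g) \<mu> * weight g)
    \<in> borel_measurable borel"
proof -
  interpret finite_measure sphere_measure by (rule finite_measure_sphere_measure)
  show ?thesis
    by (intro borel_measurable_lebesgue_integral collision_integrand_measurable assms)
qed

lemma integrable_collision_integral:
  assumes "real_polynomial_function p" "real_polynomial_function q"
    and "0 \<le> \<mu>" "- 1 \<le> e" "e \<le> 1"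
  shows "integrable lborel
    (\<lambda>g. LINT \<sigma>|sphere_measure. p (post_velocity e g \<sigma>) * q g * rpow (norm g) \<mu> * weight g)"
proof -
  interpret finite_measure sphere_measure by (rule finite_measure_sphere_measure)
  obtain K n where K: "\<And>g \<sigma>. \<sigma> \<in> sphere 0 1 \<Longrightarrow>
      \<bar>p (post_velocity e g \<sigma>) * q g * rpow (norm g) \<mu> * weight g\<bar>
        \<le> K * ((1 + norm g) ^ n * weight g)"
    using collision_integrand_bound[OF assms] by blast
  let ?A = "measure sphere_measure (space sphere_measure)"
  let ?f = "\<lambda>g \<sigma>. p (post_velocity e g \<sigma>) * q g * rpow (norm g) \<mu> * weight g"
  have "\<bar>LINT \<sigma>|sphere_measure. ?f g \<sigma>\<bar> \<le> ?A * K * ((1 + norm g) ^ n * weight g)" for g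
  proof -
    have "\<bar>LINT \<sigma>|sphere_measure. ?f g \<sigma>\<bar> \<le> (LINT \<sigma>|sphere_measure. \<bar>?f g \<sigma>\<bar>)"
      by (rule integral_abs_bound)
    also have "\<dots> \<le> (LINT \<sigma>|sphere_measure. K * ((1 + norm g) ^ n * weight g))"
      using K
      by (intro integral_mono integrable_abs integrable_collision_integrand_direction assms) auto
    finally show ?thesis by simp
  qed
  then show ?thesis
    using collision_integral_measurable[OF assms(1,2)]
    by (intro Bochner_Integration.integrable_bound
        [OF integrable_mult_right[OF integrable_power_weight, of "?A * K" n]] AE_I2)
       (auto simp: intro: order_trans[OF _ abs_ge_self])
qed

section \<open>Rescaling the relative velocity\<close>

lemma lborel_integral_scaleR:
  fixes f :: "'a::euclidean_space \<Rightarrow> real"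
  assumes c: "c \<noteq> 0" and f[measurable]: "f \<in> borel_measurable borel"
  shows "(LINT x|lborel. f (x /\<^sub>R c)) = \<bar>c\<bar> ^ DIM('a) * (LINT x|lborel. f x)"
proof -
  have "(LINT x|lborel. f (x /\<^sub>R c))
      = (LINT x|density (distr lborel borel (\<lambda>x::'a. 0 + c *\<^sub>R x)) (\<lambda>_. \<bar>c\<bar> ^ DIM('a)). f (x /\<^sub>R c))"
    by (subst lborel_affine[OF c, of 0]) (rule refl)
  also have "\<dots> = (LINT x|lborel. \<bar>c\<bar> ^ DIM('a) * f x)"
    using c by (subst integral_density) (auto simp: integral_distr)
  finally show ?thesis by simp
qed

theorem theorem3:
  fixes e C varpi :: real
    and B :: "real \<Rightarrow> real^3 \<Rightarrow> real"
    and j \<kappa> :: "nat^3"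
  assumes "0 \<le> e" "e \<le> 1"
    and "C > 0"
    and "1 / 2 \<le> varpi" "varpi \<le> 1"
    and "\<And>g \<sigma>. \<sigma> \<in> sphere 0 1 \<Longrightarrow> B (norm (g :: real^3)) \<sigma> = C * rpow (norm g) (2 * (1 - varpi))"
  shows "gamma_coeff e B j \<kappa> =
    C * 2 powr (5 / 2 - varpi) *
      (D_coeff e j \<kappa> (2 * (1 - varpi)) - psi_coeff j \<kappa> (2 * (1 - varpi)))"
proof -
  define \<mu> where "\<mu> = 2 * (1 - varpi)"
  have \<mu>: "0 \<le> \<mu>" using assms by (simp add: \<mu>_def)
  \<comment> \<open>\<open>D\<close> is the integral of \<open>I e\<close> and \<open>psi\<close> that of \<open>I (- 1)\<close>.\<close>
  define I where "I = (\<lambda>a g. LINT \<sigma>|sphere_measure.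
    hermite j (post_velocity a g \<sigma>) * hermite \<kappa> g * rpow (norm g) \<mu> * weight g)"
  \<comment> \<open>the kernel at \<open>sqrt 2 * norm h\<close> is \<open>c\<close> times the power of \<open>norm h\<close>\<close>
  define c where "c = C * rpow (sqrt 2) \<mu>"
  note poly = real_polynomial_function_hermite[of j] real_polynomial_function_hermite[of \<kappa>]
  have e: "- 1 \<le> e" "e \<le> 1" using assms by auto
  have inner: "(LINT \<sigma>|sphere_measure.
      (hermite j (post_velocity e g \<sigma> /\<^sub>R sqrt 2) - hermite j (g /\<^sub>R sqrt 2))
        * hermite \<kappa> (g /\<^sub>R sqrt 2) * B (norm g) \<sigma> * weight (g /\<^sub>R sqrt 2))
      = c * (I e (g /\<^sub>R sqrt 2) - I (- 1) (g /\<^sub>R sqrt 2))" (is "?L = _") for g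
  proof -
    define h where "h = g /\<^sub>R sqrt 2"
    have g: "norm g = sqrt 2 * norm h" by (simp add: h_def)
    have gh: "post_velocity e g \<sigma> /\<^sub>R sqrt 2 = post_velocity e h \<sigma>" for \<sigma>
      by (simp add: h_def post_velocity_scaleR)
    have "?L = (LINT \<sigma>|sphere_measure.
        c * (hermite j (post_velocity e h \<sigma>) * hermite \<kappa> h * rpow (norm h) \<mu> * weight h
           - hermite j (post_velocity (- 1) h \<sigma>) * hermite \<kappa> h * rpow (norm h) \<mu> * weight h))"
    proof (rule Bochner_Integration.integral_cong[OF refl])
      fix \<sigma> assume "\<sigma> \<in> space sphere_measure"
      then have "B (norm g) \<sigma> = c * rpow (norm h) \<mu>"
        using assms(6)[of \<sigma> g] by (simp add: c_def g rpow_mult \<mu>_def)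
      then show "(hermite j (post_velocity e g \<sigma> /\<^sub>R sqrt 2) - hermite j (g /\<^sub>R sqrt 2))
        * hermite \<kappa> (g /\<^sub>R sqrt 2) * B (norm g) \<sigma> * weight (g /\<^sub>R sqrt 2) =
        c * (hermite j (post_velocity e h \<sigma>) * hermite \<kappa> h * rpow (norm h) \<mu> * weight h
           - hermite j (post_velocity (- 1) h \<sigma>) * hermite \<kappa> h * rpow (norm h) \<mu> * weight h)"
        by (simp add: gh post_velocity_minus_one flip: h_def) (simp add: algebra_simps)
    qed
    also have "\<dots> = c * (I e h - I (- 1) h)"
      unfolding I_def
      by (subst integral_mult_right_zero, subst Bochner_Integration.integral_diff)
         (use integrable_collision_integrand_direction[OF poly \<mu>] e in auto)
    finally show ?thesis by (simp add: h_def)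
  qed
  have "gamma_coeff e B j \<kappa> = (LINT g|lborel. c * (I e (g /\<^sub>R sqrt 2) - I (- 1) (g /\<^sub>R sqrt 2)))"
    unfolding gamma_coeff_def inner ..
  also have "\<dots> = sqrt 2 ^ 3 * (LINT g|lborel. c * (I e g - I (- 1) g))"
    using collision_integral_measurable[OF poly]
    by (subst lborel_integral_scaleR[of "sqrt 2" "\<lambda>g. c * (I e g - I (- 1) g)"])
       (auto simp: I_def)
  also have "(LINT g|lborel. c * (I e g - I (- 1) g))
      = c * ((LINT g|lborel. I e g) - (LINT g|lborel. I (- 1) g))"
    using integrable_collision_integral[OF poly \<mu>] e by (simp add: I_def)
  also have "(LINT g|lborel. I e g) = D_coeff e j \<kappa> \<mu>"
    by (simp add: I_def D_coeff_def)
  also have "(LINT g|lborel. I (- 1) g) = psi_coeff j \<kappa> \<mu>"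
    by (simp add: I_def psi_coeff_def post_velocity_minus_one)
  also have "sqrt 2 ^ 3 * (c * (D_coeff e j \<kappa> \<mu> - psi_coeff j \<kappa> \<mu>))
      = C * 2 powr (5 / 2 - varpi) * (D_coeff e j \<kappa> \<mu> - psi_coeff j \<kappa> \<mu>)"
  proof -
    have "sqrt 2 ^ 3 = (2::real) powr (3 / 2)"
      by (simp add: powr_half_sqrt powr_powr flip: powr_realpow powr_half_sqrt)
    moreover have "rpow (sqrt 2) \<mu> = 2 powr (1 - varpi)"
      by (auto simp: rpow_def \<mu>_def powr_powr algebra_simps simp flip: powr_half_sqrt)
    ultimately have "sqrt 2 ^ 3 * c = C * 2 powr (5 / 2 - varpi)"
      by (simp add: c_def flip: powr_add)
    then show ?thesis by (simp flip: mult.assoc)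
  qed
  finally show ?thesis by (simp add: \<mu>_def)
qed

end
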